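(* Let $n=\prod_{i=1}^k p_i^{\alpha_i}$ be the prime factorization of an integer $n>1$ with $\alpha_i>0$ for all $i$, and let $a\in GP(\mathbb Z_n)\setminus P(\mathbb Z_n)$. If $a$ is a unit of $\mathbb Z_n$, then $a_u=1$. If $a$ is not a unit of $\mathbb Z_n$, then $a_u=b^{\varphi(n/b)}$ (computed in $\mathbb Z_n$), where $b=\prod_{j:\ a\equiv 0 \pmod{p_j^{\alpha_j}}} p_j^{\alpha_j}$ and $\varphi$ is Euler's totient function.
   Context: On $\mathbb Z_n$ define the partial order $\leq$ by: $a\leq b$ iff $a=b$ or $a\equiv ab\pmod n$; write $a<b$ for $a\leq b$, $a\neq b$. $GP(\mathbb Z_n)$ is the set of $a\in\mathbb Z_n$ with $a^m=a$ for some integer $m\geq2$, and $P(\mathbb Z_n)=\{a: a^2=a\}$. For $a\in GP(\mathbb Z_n)\setminus P(\mathbb Z_n)$, the upper covering projection $a_u$ is the unique element of $GP(\mathbb Z_n)$ that is an upper cover of $a$ in the poset $(GP(\mathbb Z_n),\leq)$; it is known to exist, to be a projection, and to satisfy: for $x\in GP(\mathbb Z_n)$, $a<x$ iff $a_u\leq x$ (i.e. $a_u$ is the least element of $\{x\in GP(\mathbb Z_n): a<x\}$). *)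

theory Defs
  imports "HOL-Number_Theory.Number_Theory"
begin

text \<open>The notions below are stated for an arbitrary structure \<open>R\<close>;
  \<open>\<int>\<^sub>n\<close> is \<open>residue_ring (int n)\<close>, whose elements are the least residues
  \<open>0, \<dots>, n - 1\<close>.\<close>

definition le_proj :: "('a, 'm) monoid_scheme \<Rightarrow> 'a \<Rightarrow> 'a \<Rightarrow> bool" where
  "le_proj R a b \<longleftrightarrow> a = b \<or> a = a \<otimes>\<^bsub>R\<^esub> b"

definition less_proj :: "('a, 'm) monoid_scheme \<Rightarrow> 'a \<Rightarrow> 'a \<Rightarrow> bool" where
  "less_proj R a b \<longleftrightarrow> le_proj R a b \<and> a \<noteq> b"

definition projections :: "('a, 'm) monoid_scheme \<Rightarrow> 'a set" where
  "projections R = {a \<in> carrier R. a [^]\<^bsub>R\<^esub> (2::nat) = a}"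

definition gen_projections :: "('a, 'm) monoid_scheme \<Rightarrow> 'a set" where
  "gen_projections R = {a \<in> carrier R. \<exists>m::nat. m \<ge> 2 \<and> a [^]\<^bsub>R\<^esub> m = a}"

definition upper_cover_gp :: "('a, 'm) monoid_scheme \<Rightarrow> 'a \<Rightarrow> 'a \<Rightarrow> bool" where
  "upper_cover_gp R a x \<longleftrightarrow> x \<in> gen_projections R \<and> less_proj R a x \<and>
     (\<nexists>y. y \<in> gen_projections R \<and> less_proj R a y \<and> less_proj R y x)"

definition upper_cov_proj :: "('a, 'm) monoid_scheme \<Rightarrow> 'a \<Rightarrow> 'a" where
  "upper_cov_proj R a = (THE x. upper_cover_gp R a x)"

lemma ex1_upper_cover_gp:
  assumes "comm_monoid R" and "a \<in> gen_projections R - projections R"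
  shows "\<exists>!x. upper_cover_gp R a x"
proof -
  interpret comm_monoid R by fact
  from assms(2) obtain m :: nat where a: "a \<in> carrier R" and m: "m \<ge> 2" "a [^]\<^bsub>R\<^esub> m = a"
    and np: "a [^]\<^bsub>R\<^esub> (2::nat) \<noteq> a"
    by (auto simp: gen_projections_def projections_def)
  have "m \<noteq> 2" using m(2) np by auto
  with m(1) obtain k where k: "m = k + 3" by (metis Suc_leI add.commute eval_nat_numeral(3) le_Suc_ex nat_less_le)
  define e where "e = a [^]\<^bsub>R\<^esub> (k + 2)"
  have eC: "e \<in> carrier R" using a by (simp add: e_def)
  have ae: "a \<otimes>\<^bsub>R\<^esub> e = a"
    using m(2) a k by (simp add: e_def nat_pow_mult[symmetric] m_ac numeral_3_eq_3 numeral_2_eq_2)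
  have e_split: "e = a [^]\<^bsub>R\<^esub> (k + 1) \<otimes>\<^bsub>R\<^esub> a"
    by (simp add: e_def)
  have absorb: "e \<otimes>\<^bsub>R\<^esub> x = e" if "x \<in> carrier R" "a \<otimes>\<^bsub>R\<^esub> x = a" for x
    using that a unfolding e_split by (simp add: m_assoc)
  have ee: "e \<otimes>\<^bsub>R\<^esub> e = e" using absorb[OF eC ae] .
  have sq: "e [^]\<^bsub>R\<^esub> (2::nat) = e" using ee eC by (simp add: numeral_2_eq_2)
  have neq: "a \<noteq> e" using sq np by auto
  have eG: "e \<in> gen_projections R" using eC sq by (auto simp: gen_projections_def)
  have lt: "less_proj R a e" using ae neq by (simp add: less_proj_def le_proj_def)
  have least: "le_proj R e x" if "x \<in> gen_projections R" "less_proj R a x" for x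
    using that absorb[of x] by (auto simp: gen_projections_def less_proj_def le_proj_def)
  have anti: "x = y" if "le_proj R x y" "le_proj R y x" "x \<in> carrier R" "y \<in> carrier R" for x y
    using that m_comm[of x y] by (auto simp: le_proj_def)
  show ?thesis
  proof
    show "upper_cover_gp R a e"
      unfolding upper_cover_gp_def
      using eG lt least anti eC by (auto simp: less_proj_def gen_projections_def)
  next
    fix x assume "upper_cover_gp R a x"
    then show "x = e"
      using least eG lt unfolding upper_cover_gp_def by (metis less_proj_def)
  qed
qed

end

theory Submission
  imports Defs
begin

text \<open>
  The upper covering projection of \<open>a\<close> is the only \<open>e\<close> with \<open>a e = a\<close> that is a
  multiple of \<open>a\<close>. For a unit \<open>a\<close>, \<open>e = 1\<close> has both properties. In general, \<open>a^m = a\<close> forces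
  \<open>p\<^sub>j ^ \<alpha>\<^sub>j\<close> to divide \<open>a\<close> as soon as \<open>p\<^sub>j\<close> does, so \<open>n = b d\<close> with \<open>b\<close> and \<open>d\<close> coprime,
  \<open>b\<close> dividing \<open>a\<close>, and \<open>a\<close> invertible modulo \<open>d\<close>. By Euler's theorem \<open>b ^ \<phi>(d)\<close> is \<open>0\<close>
  modulo \<open>b\<close> and \<open>1\<close> modulo \<open>d\<close>, and these two congruences yield both properties.
\<close>

text \<open>If \<open>a x = a\<close>, then \<open>e x = c a x = c a = e\<close>, so
  \<open>e\<close> lies below every generalized projection above \<open>a\<close>. Taking
  \<open>x = e\<close> makes \<open>e\<close> idempotent and hence different from
  \<open>a\<close>.\<close>

lemma upper_cov_proj_eqI:
  assumes "comm_monoid R" and a: "a \<in> gen_projections R - projections R"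
    and e: "e \<in> carrier R" "a \<otimes>\<^bsub>R\<^esub> e = a" and c: "c \<in> carrier R" "e = c \<otimes>\<^bsub>R\<^esub> a"
  shows "upper_cov_proj R a = e"
proof -
  interpret comm_monoid R by fact
  have aC: "a \<in> carrier R" and np: "a \<otimes>\<^bsub>R\<^esub> a \<noteq> a"
    using a by (auto simp: gen_projections_def projections_def numeral_2_eq_2)
  have absorb: "e \<otimes>\<^bsub>R\<^esub> x = e" if "x \<in> carrier R" "a \<otimes>\<^bsub>R\<^esub> x = a" for x
    using that aC c by (simp add: m_assoc)
  have ee: "e \<otimes>\<^bsub>R\<^esub> e = e" using absorb e by blast
  have neq: "a \<noteq> e" using ee np by auto
  have eG: "e \<in> gen_projections R"
    using e ee by (auto simp: gen_projections_def numeral_2_eq_2 intro!: exI[of _ 2])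
  have lt: "less_proj R a e" using e neq by (simp add: less_proj_def le_proj_def)
  have least: "e \<otimes>\<^bsub>R\<^esub> y = e" if "y \<in> gen_projections R" "less_proj R a y" for y
    using that absorb[of y] by (auto simp: gen_projections_def less_proj_def le_proj_def)
  have "upper_cover_gp R a e"
    unfolding upper_cover_gp_def
  proof (intro conjI notI eG lt)
    assume "\<exists>y. y \<in> gen_projections R \<and> less_proj R a y \<and> less_proj R y e"
    then obtain y where y: "y \<in> gen_projections R" "less_proj R a y" "less_proj R y e"
      by blast
    then have "y \<in> carrier R" by (simp add: gen_projections_def)
    \<comment> \<open>Leastness gives \<open>e y = e\<close>, while \<open>y < e\<close> gives
      \<open>y e = y\<close>; by commutativity \<open>y = e\<close>, contradicting
      strictness.\<close>
    with y least[of y] e m_comm[of e y] show False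
      by (auto simp: less_proj_def le_proj_def)
  qed
  then show ?thesis
    unfolding upper_cov_proj_def
    by (intro the1_equality ex1_upper_cover_gp assms)
qed

lemma upper_cov_proj_Units:
  assumes "comm_monoid R" "a \<in> gen_projections R - projections R" "a \<in> Units R"
  shows "upper_cov_proj R a = \<one>\<^bsub>R\<^esub>"
proof -
  interpret comm_monoid R by fact
  show ?thesis
    using assms by (intro upper_cov_proj_eqI[where c = "inv\<^bsub>R\<^esub> a"]) auto
qed

text \<open>The prime power divides \<open>a (a^(m-1) - 1)\<close>. As \<open>m - 1 > 0\<close> and
  \<open>p\<close> divides \<open>a\<close>, it cannot divide the second factor, so all of
  \<open>p ^ k\<close> goes into \<open>a\<close>.\<close>

lemma power_dvd_of_cong_power:
  fixes a :: int
  assumes "prime p" "[a ^ m = a] (mod p ^ k)" "m \<ge> 2" "p dvd a"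
  shows "p ^ k dvd a"
proof -
  obtain l where l: "m = Suc (Suc l)"
    using assms(3) by (metis Suc_le_D numeral_2_eq_2 Suc_le_mono)
  have "a ^ m - a = a * (a ^ Suc l - 1)"
    by (simp add: l algebra_simps)
  with assms(2) have dvd: "p ^ k dvd a * (a ^ Suc l - 1)"
    by (simp add: cong_iff_dvd_diff)
  have "\<not> p dvd a ^ Suc l - 1"
  proof
    assume "p dvd a ^ Suc l - 1"
    moreover have "p dvd a ^ Suc l" using assms(4) by simp
    ultimately have "p dvd a ^ Suc l - (a ^ Suc l - 1)" by (rule dvd_diff[rotated])
    then show False using assms(1) by (simp add: not_prime_unit)
  qed
  then have "coprime (p ^ k) (a ^ Suc l - 1)"
    using assms(1) by (simp add: prime_imp_coprime)
  with dvd show ?thesis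
    by (metis coprime_dvd_mult_left_iff)
qed

text \<open>Only a coprime splitting of the modulus matters here; the prime factorization enters
  later, to produce \<open>b\<close> and \<open>d\<close>.\<close>

lemma upper_cov_proj_residue_ring:
  fixes b d :: nat and a :: int
  assumes n: "b * d > 1" and bd: "coprime b d" and ba: "int b dvd a" and ad: "coprime a (int d)"
    and a: "a \<in> gen_projections (residue_ring (int (b * d))) - projections (residue_ring (int (b * d)))"
  shows "upper_cov_proj (residue_ring (int (b * d))) a =
    (int b mod int (b * d)) [^]\<^bsub>residue_ring (int (b * d))\<^esub> totient d"
proof -
  define n where "n = int (b * d)"
  define R where "R = residue_ring n"
  have n1: "n > 1" using n by (simp add: n_def flip: of_nat_mult)
  interpret residues n R
    using n1 by (simp_all add: residues_def R_def)
  have d0: "d > 0" using n by (cases d) auto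
  define e where "e = int b ^ totient d mod n"
  have e_eq: "(int b mod n) [^]\<^bsub>R\<^esub> totient d = e"
    by (simp add: e_def pow_cong)
  have aR: "a mod n = a"
    using a by (auto simp: gen_projections_def residue_ring_def n_def)
  have cong_n: "[x = y] (mod n)" if "[x = y] (mod int b)" "[x = y] (mod int d)" for x y
    using that bd by (simp add: n_def coprime_cong_mult)
  have e_b: "[e = 0] (mod int b)"
  proof -
    \<comment> \<open>Since \<open>d > 0\<close>, the exponent \<open>totient d\<close> is positive,
      so the power keeps a factor \<open>b\<close>.\<close>
    have "int b dvd int b ^ totient d" using d0 by simp
    then show ?thesis
      by (simp add: e_def n_def cong_0_iff dvd_mod)
  qed
  have e_d: "[e = 1] (mod int d)"
  proof -
    have "[b ^ totient d = 1] (mod d)" using bd by (rule Residues.euler_theorem)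
    then have "[int b ^ totient d = 1] (mod int d)"
      by (metis cong_int_iff of_nat_1 of_nat_power)
    then show ?thesis
      by (simp add: e_def n_def cong_def mod_mod_cancel)
  qed
  \<comment> \<open>An inverse of \<open>a\<close> modulo \<open>d\<close> exhibits \<open>e\<close>
    as a multiple of \<open>a\<close>: modulo \<open>b\<close> both \<open>e\<close> and
    \<open>c * a\<close> vanish, modulo \<open>d\<close> both are 1.\<close>
  obtain c where c: "[a * c = 1] (mod int d)"
    using ad cong_solve_coprime_int by blast
  have "[a * e = a] (mod n)"
  proof (rule cong_n)
    show "[a * e = a] (mod int b)" using ba by (simp add: cong_iff_dvd_diff)
    show "[a * e = a] (mod int d)" using cong_scalar_left[OF e_d, of a] by simp
  qed
  then have "a \<otimes>\<^bsub>R\<^esub> e = a"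
    using aR by (simp add: res_mult_eq cong_def)
  moreover have "[e = c * a] (mod n)"
  proof (rule cong_n)
    show "[e = c * a] (mod int b)"
      using e_b ba by (simp add: cong_iff_dvd_diff)
    show "[e = c * a] (mod int d)"
      using e_d c by (metis cong_sym cong_trans mult.commute)
  qed
  then have "e = (c mod n) \<otimes>\<^bsub>R\<^esub> a"
    by (simp add: res_mult_eq cong_def e_def mod_mult_left_eq)
  moreover have "e \<in> carrier R" "c mod n \<in> carrier R"
    using n1 by (auto simp: e_def)
  ultimately have "upper_cov_proj R a = e"
    using a unfolding R_def n_def[symmetric]
    by (intro upper_cov_proj_eqI[OF comm_monoid_axioms, unfolded R_def, where c = "c mod n"])
  then show ?thesis using e_eq by (simp add: R_def n_def)
qed

theorem theorem2p4:
  fixes n k :: nat and p \<alpha> :: "nat \<Rightarrow> nat" and a :: int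
  assumes "n > 1"
    and "n = (\<Prod>i=1..k. p i ^ \<alpha> i)"
    and "\<And>i. i \<in> {1..k} \<Longrightarrow> prime (p i)"
    and "inj_on p {1..k}"
    and "\<And>i. i \<in> {1..k} \<Longrightarrow> \<alpha> i > 0"
    and "a \<in> gen_projections (residue_ring (int n)) - projections (residue_ring (int n))"
  shows "(a \<in> Units (residue_ring (int n)) \<longrightarrow>
            upper_cov_proj (residue_ring (int n)) a = \<one>\<^bsub>residue_ring (int n)\<^esub>) \<and>
         (a \<notin> Units (residue_ring (int n)) \<longrightarrow>
            (let b = (\<Prod>j\<in>{j \<in> {1..k}. [a = 0] (mod int (p j ^ \<alpha> j))}. p j ^ \<alpha> j)
             in upper_cov_proj (residue_ring (int n)) a =
                (int b mod int n) [^]\<^bsub>residue_ring (int n)\<^esub> totient (n div b)))"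
proof -
  let ?R = "residue_ring (int n)"
  interpret residues "int n" ?R
    using assms(1) by (simp_all add: residues_def)
  obtain m where m: "m \<ge> 2" "a [^]\<^bsub>?R\<^esub> (m::nat) = a" and aR: "a mod int n = a"
    using assms(6) by (auto simp: gen_projections_def residue_ring_def)
  have "[a ^ m = a] (mod int n)"
    using m(2) pow_cong[of a m] aR by (simp add: cong_def)
  define J where "J = {j \<in> {1..k}. [a = 0] (mod int (p j ^ \<alpha> j))}"
  define b where "b = (\<Prod>j\<in>J. p j ^ \<alpha> j)"
  define d where "d = (\<Prod>j\<in>{1..k} - J. p j ^ \<alpha> j)"
  have J: "J \<subseteq> {1..k}" by (auto simp: J_def)
  have n: "n = b * d"
    using prod.subset_diff[OF J, of "\<lambda>j. p j ^ \<alpha> j"] assms(2) by (simp add: b_def d_def mult.commute)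
  have cop: "coprime (p i ^ \<alpha> i) (p j ^ \<alpha> j)" if "i \<in> {1..k}" "j \<in> {1..k}" "i \<noteq> j" for i j
    using that assms(3,4) by (auto simp: inj_on_eq_iff intro: primes_coprime)
  have bd: "coprime b d"
    unfolding b_def d_def
    by (intro prod_coprime_left prod_coprime_right cop) (use J in auto)
  \<comment> \<open>The factors of \<open>b\<close> are pairwise coprime, so their separate
    divisibilities of \<open>a\<close> combine.\<close>
  have ba: "int b dvd a"
    unfolding b_def of_nat_prod
    by (subst cong_0_iff[symmetric], rule cong_cong_prod_coprime)
      (use cop J in \<open>auto simp: J_def simp flip: of_nat_power\<close>)
  have ad: "coprime a (int d)"
    unfolding d_def of_nat_prod
  proof (rule prod_coprime_right)
    \<comment> \<open>If \<open>p j\<close> divided \<open>a\<close>, then so would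
      \<open>p j ^ \<alpha> j\<close>, which would put \<open>j\<close> into
      \<open>J\<close>.\<close>
    fix j assume j: "j \<in> {1..k} - J"
    then have "p j ^ \<alpha> j dvd n"
      unfolding assms(2) by (intro dvd_prodI) auto
    then have "[a ^ m = a] (mod int (p j) ^ \<alpha> j)"
      using \<open>[a ^ m = a] (mod int n)\<close> by (metis cong_dvd_modulus of_nat_dvd_iff of_nat_power)
    moreover have "\<not> int (p j) ^ \<alpha> j dvd a" using j by (auto simp: J_def cong_0_iff)
    moreover have pj: "prime (int (p j))" using j assms(3) by simp
    ultimately have "\<not> int (p j) dvd a" using power_dvd_of_cong_power m(1) by blast
    then show "coprime a (int (p j ^ \<alpha> j))"
      using prime_imp_coprime[OF pj] by (simp add: coprime_commute)
  qed
  \<comment> \<open>Here \<open>n > 1\<close> excludes \<open>b = 0\<close>, where division would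
    return the default 0.\<close>
  have "d = n div b" using n assms(1) by (cases "b = 0") auto
  then have "upper_cov_proj ?R a = (int b mod int n) [^]\<^bsub>?R\<^esub> totient (n div b)"
    using upper_cov_proj_residue_ring[of b d a] bd ba ad assms(1,6) n by simp
  moreover have "upper_cov_proj ?R a = \<one>\<^bsub>?R\<^esub>" if "a \<in> Units ?R"
    using that assms(6) by (intro upper_cov_proj_Units comm_monoid_axioms)
  ultimately show ?thesis
    by (simp add: b_def J_def Let_def)
qed

end
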